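(* Let $R$ be a commutative ring with identity whose set of zero-divisors $Z_R$ satisfies $Z_R\ne\{0\}$, and let $n>1$. Then the orthogonality graph $O(M_n(R))$ is connected and has diameter $3$ or $4$. Its diameter equals $3$ if and only if $$\forall a_0\in Z_R\ \ \exists a_1,a_2\in R\setminus\{0\}\ \ \forall i,j\in\{0,1,2\},\ i\ne j:\ a_ia_j=0.$$ Moreover, every vertex of $O(M_n(R))$ is at distance at most $2$ from some scalar matrix $bE$, $b\in R$, that is itself a vertex of $O(M_n(R))$.
   Context: All rings are associative with identity. For a commutative ring $R$, $Z_R=\{a\in R:\ ax=0\text{ for some }x\ne0\}$ is the set of zero-divisors (it contains $0$). For a ring $S$, an element $x$ is a two-sided zero-divisor if there exist nonzero $y,z\in S$ with $xy=0$ and $zx=0$. The orthogonality graph $O(S)$ is the undirected graph whose vertices are the nonzero two-sided zero-divisors of $S$, with distinct vertices $x,y$ adjacent iff $xy=yx=0$. Distance $d(x,y)$ is the minimal length of a path (infinite if none); the diameter is the supremum of all distances. $E$ denotes the identity matrix; $M_n(R)$ is the ring of $n\times n$ matrices over $R$. *)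

theory Defs
  imports "HOL-Analysis.Analysis" "HOL-Library.Extended_Nat"
begin

(* Zero-divisors of a commutative ring: Z_R = {a. a*x = 0 for some x \<noteq> 0} *)
definition zero_divisors :: "'a::comm_ring_1 set" where
  "zero_divisors = {a. \<exists>x. x \<noteq> 0 \<and> a * x = 0}"

(* Orthogonality graph of a ring S, given by its multiplication m (and 0).
   Vertices: nonzero two-sided zero-divisors. *)
definition orth_vertices :: "('b::zero \<Rightarrow> 'b \<Rightarrow> 'b) \<Rightarrow> 'b set" where
  "orth_vertices m = {x. x \<noteq> 0 \<and> (\<exists>y. y \<noteq> 0 \<and> m x y = 0) \<and> (\<exists>z. z \<noteq> 0 \<and> m z x = 0)}"

definition orth_adj :: "('b::zero \<Rightarrow> 'b \<Rightarrow> 'b) \<Rightarrow> 'b \<Rightarrow> 'b \<Rightarrow> bool" where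
  "orth_adj m x y \<longleftrightarrow> x \<in> orth_vertices m \<and> y \<in> orth_vertices m \<and> x \<noteq> y
      \<and> m x y = 0 \<and> m y x = 0"

(* a walk of length k from x to y in the orthogonality graph *)
definition orth_walk :: "('b::zero \<Rightarrow> 'b \<Rightarrow> 'b) \<Rightarrow> 'b \<Rightarrow> 'b \<Rightarrow> nat \<Rightarrow> bool" where
  "orth_walk m x y k \<longleftrightarrow> (\<exists>p :: nat \<Rightarrow> 'b. p 0 = x \<and> p k = y \<and>
      (\<forall>i<k. orth_adj m (p i) (p (Suc i))))"

(* distance: minimal length of a path, infinite if none *)
definition orth_dist :: "('b::zero \<Rightarrow> 'b \<Rightarrow> 'b) \<Rightarrow> 'b \<Rightarrow> 'b \<Rightarrow> enat" where
  "orth_dist m x y = (if \<exists>k. orth_walk m x y k then enat (LEAST k. orth_walk m x y k) else \<infinity>)"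

definition orth_connected :: "('b::zero \<Rightarrow> 'b \<Rightarrow> 'b) \<Rightarrow> bool" where
  "orth_connected m \<longleftrightarrow> (\<forall>x\<in>orth_vertices m. \<forall>y\<in>orth_vertices m. orth_dist m x y \<noteq> \<infinity>)"

(* diameter: supremum of all distances *)
definition orth_diam :: "('b::zero \<Rightarrow> 'b \<Rightarrow> 'b) \<Rightarrow> enat" where
  "orth_diam m = (SUP x\<in>orth_vertices m. SUP y\<in>orth_vertices m. orth_dist m x y)"

end

theory Submission
  imports Defs "Jordan_Normal_Form.Determinant"
begin

text \<open>Every vertex \<open>A\<close> of the orthogonality graph of \<open>M\<^sub>n(R)\<close> has \<open>det A \<in> Z(R)\<close> (multiply a
  one-sided annihilator by the adjugate), and McCoy's theorem turns any \<open>r \<noteq> 0\<close> with \<open>r det A = 0\<close>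
  into a nonzero two-sided annihilator of \<open>A\<close> in \<open>r M\<^sub>n(R)\<close>. Given \<open>z w = 0\<close> with \<open>z, w \<noteq> 0\<close>, one of
  \<open>C\<close>, \<open>w C\<close> is a two-sided annihilator of \<open>A\<close> killed by a nonzero scalar \<open>b\<close>, giving the path
  \<open>A - C - bE\<close>; attaching an annihilator of a second vertex \<open>B\<close> gives distance at most 4.
  If \<open>det A\<close> has nonzero annihilators \<open>a\<^sub>1, a\<^sub>2\<close> with \<open>a\<^sub>1 a\<^sub>2 = 0\<close>, the McCoy annihilators
  \<open>a\<^sub>1X\<^sub>1, a\<^sub>2X\<^sub>2\<close> of \<open>A\<close> and an annihilator \<open>Y\<close> of \<open>B\<close> give the path \<open>A - a\<^sub>1X\<^sub>1 - Y - B\<close> if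
  \<open>a\<^sub>1Y = 0\<close> and \<open>A - a\<^sub>2X\<^sub>2 - a\<^sub>1Y - B\<close> otherwise. Conversely, the neighbours of \<open>diag(a, 1, \<dots>, 1)\<close>
  are the multiples of \<open>E\<^sub>1\<^sub>1\<close> killed by \<open>a\<close> and those of \<open>E\<^sub>1\<^sub>2 + aE\<^sub>2\<^sub>1 + \<Sum>\<^sub>k\<^sub>>\<^sub>2 E\<^sub>k\<^sub>k\<close> are
  the multiples of \<open>E\<^sub>1\<^sub>2\<close> killed by \<open>a\<close>; so these vertices are at distance at least 3, and
  at distance 3 only if \<open>a\<close> has two nonzero annihilators that annihilate each other.\<close>

section \<open>Minors and McCoy's theorem\<close>

lemma nth_set_lessThan: "set xs \<subseteq> {..<n} \<Longrightarrow> i < length xs \<Longrightarrow> xs ! i < n"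
  by (meson lessThan_iff nth_mem subsetD)

lemma set_update_lessThan:
  "set xs \<subseteq> {..<n} \<Longrightarrow> k < n \<Longrightarrow> set (xs[a := k]) \<subseteq> {..<n}"
  using set_update_subset_insert by fastforce

definition select_mat :: "'a mat \<Rightarrow> nat list \<Rightarrow> nat list \<Rightarrow> 'a mat" where
  "select_mat A ps qs = mat (length ps) (length qs) (\<lambda>(a, b). A $$ (ps ! a, qs ! b))"

lemma select_mat_carrier [simp]: "select_mat A ps qs \<in> carrier_mat (length ps) (length qs)"
  and select_mat_dim [simp]: "dim_row (select_mat A ps qs) = length ps" "dim_col (select_mat A ps qs) = length qs"
  by (simp_all add: select_mat_def)

lemma select_mat_index [simp]:
  "a < length ps \<Longrightarrow> b < length qs \<Longrightarrow> select_mat A ps qs $$ (a, b) = A $$ (ps ! a, qs ! b)"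
  by (simp add: select_mat_def)

lemma select_mat_one_mult:
  fixes A :: "'a::comm_ring_1 mat"
  assumes A: "A \<in> carrier_mat n m" and ps: "set ps \<subseteq> {..<n}"
  shows "select_mat (1\<^sub>m n) ps [0..<n] * A = select_mat A ps [0..<m]"
proof (rule eq_matI)
  fix a b assume ab: "a < dim_row (select_mat A ps [0..<m])" "b < dim_col (select_mat A ps [0..<m])"
  hence p: "ps ! a < n" using nth_set_lessThan[OF ps] by simp
  have "(select_mat (1\<^sub>m n) ps [0..<n] * A) $$ (a, b) = (\<Sum>k<n. (if ps ! a = k then 1 else 0) * A $$ (k, b))"
    using A ab p by (simp add: scalar_prod_def atLeast0LessThan)
  also have "\<dots> = (\<Sum>k<n. if ps ! a = k then A $$ (k, b) else 0)"
    by (intro sum.cong) auto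
  also have "\<dots> = A $$ (ps ! a, b)"
    using p by simp
  finally show "(select_mat (1\<^sub>m n) ps [0..<n] * A) $$ (a, b) = select_mat A ps [0..<m] $$ (a, b)"
    using ab by simp
qed (use A in auto)

lemma mult_select_mat_one:
  fixes A :: "'a::comm_ring_1 mat"
  assumes A: "A \<in> carrier_mat m n" and qs: "set qs \<subseteq> {..<n}"
  shows "A * select_mat (1\<^sub>m n) [0..<n] qs = select_mat A [0..<m] qs"
proof (rule eq_matI)
  fix a b assume ab: "a < dim_row (select_mat A [0..<m] qs)" "b < dim_col (select_mat A [0..<m] qs)"
  hence q: "qs ! b < n" using nth_set_lessThan[OF qs] by simp
  have "(A * select_mat (1\<^sub>m n) [0..<n] qs) $$ (a, b) = (\<Sum>k<n. A $$ (a, k) * (if k = qs ! b then 1 else 0))"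
    using A ab q by (simp add: scalar_prod_def atLeast0LessThan)
  also have "\<dots> = (\<Sum>k<n. if qs ! b = k then A $$ (a, k) else 0)"
    by (intro sum.cong) auto
  also have "\<dots> = A $$ (a, qs ! b)"
    using q by simp
  finally show "(A * select_mat (1\<^sub>m n) [0..<n] qs) $$ (a, b) = select_mat A [0..<m] qs $$ (a, b)"
    using ab by simp
qed (use A in auto)

lemma det_dvd_det_select_mat:
  fixes A :: "'a::comm_ring_1 mat"
  assumes A: "A \<in> carrier_mat n n" and len: "length ps = n" "length qs = n"
    and ps: "set ps \<subseteq> {..<n}" and qs: "set qs \<subseteq> {..<n}"
  shows "det A dvd det (select_mat A ps qs)"
proof -
  let ?P = "select_mat (1\<^sub>m n) ps [0..<n]" and ?Q = "select_mat (1\<^sub>m n) [0..<n] qs"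
  have P: "?P \<in> carrier_mat n n" and Q: "?Q \<in> carrier_mat n n"
    using select_mat_carrier[of "1\<^sub>m n" ps "[0..<n]"] select_mat_carrier[of "1\<^sub>m n" "[0..<n]" qs] len
    by simp_all
  have "?P * A * ?Q = select_mat A ps [0..<n] * ?Q"
    by (simp only: select_mat_one_mult[OF A ps])
  also have "\<dots> = select_mat (select_mat A ps [0..<n]) [0..<n] qs"
    by (rule mult_select_mat_one[OF _ qs]) (use select_mat_carrier[of A ps "[0..<n]"] len in simp)
  also have "\<dots> = select_mat A ps qs"
  proof (rule eq_matI)
    fix a b assume ab: "a < dim_row (select_mat A ps qs)" "b < dim_col (select_mat A ps qs)"
    hence "qs ! b < n" using nth_set_lessThan[OF qs] by simp
    thus "select_mat (select_mat A ps [0..<n]) [0..<n] qs $$ (a, b) = select_mat A ps qs $$ (a, b)"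
      using ab len by simp
  qed (simp_all add: len)
  finally have "det (select_mat A ps qs) = det (?P * A * ?Q)"
    by (simp only:)
  also have "\<dots> = det A * (det ?P * det ?Q)"
    by (simp only: det_mult[OF mult_carrier_mat[OF P A] Q] det_mult[OF P A] ac_simps)
  finally show ?thesis by (rule dvdI)
qed

definition embedded_adj :: "nat \<Rightarrow> 'a::comm_ring_1 mat \<Rightarrow> nat list \<Rightarrow> nat list \<Rightarrow> 'a mat" where
  "embedded_adj n A ps qs = mat n n (\<lambda>(x, y). \<Sum>a<length ps. \<Sum>b<length qs.
     if qs ! b = x \<and> ps ! a = y then cofactor (select_mat A ps qs) a b else 0)"

lemma embedded_adj_carrier [simp]: "embedded_adj n A ps qs \<in> carrier_mat n n"
  and embedded_adj_dim [simp]: "dim_row (embedded_adj n A ps qs) = n" "dim_col (embedded_adj n A ps qs) = n"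
  by (simp_all add: embedded_adj_def)

lemma embedded_adj_index:
  "x < n \<Longrightarrow> y < n \<Longrightarrow> embedded_adj n A ps qs $$ (x, y) = (\<Sum>a<length ps. \<Sum>b<length qs.
     if qs ! b = x \<and> ps ! a = y then cofactor (select_mat A ps qs) a b else 0)"
  by (simp add: embedded_adj_def)

lemma cofactor_select_mat_update:
  "cofactor (select_mat A (ps[a := k]) qs) a b = cofactor (select_mat A ps qs) a b"
proof -
  have "mat_delete (select_mat A (ps[a := k]) qs) a b = mat_delete (select_mat A ps qs) a b"
  proof (rule eq_matI)
    fix i j assume "i < dim_row (mat_delete (select_mat A ps qs) a b)" "j < dim_col (mat_delete (select_mat A ps qs) a b)"
    moreover define i' where "i' = (if i < a then i else Suc i)"
    moreover define j' where "j' = (if j < b then j else Suc j)"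
    ultimately have "i' < length ps" "j' < length qs" "i' \<noteq> a" by auto
    thus "mat_delete (select_mat A (ps[a := k]) qs) a b $$ (i, j) = mat_delete (select_mat A ps qs) a b $$ (i, j)"
      using \<open>i < _\<close> \<open>j < _\<close> by (simp add: mat_delete_def flip: i'_def j'_def)
  qed simp_all
  thus ?thesis by (simp add: cofactor_def)
qed

lemma mult_embedded_adj_index:
  fixes A :: "'a::comm_ring_1 mat"
  assumes A: "A \<in> carrier_mat n n" and len: "length qs = length ps"
    and qs: "set qs \<subseteq> {..<n}" and k: "k < n" and y: "y < n"
  shows "(A * embedded_adj n A ps qs) $$ (k, y) =
    (\<Sum>a<length ps. if ps ! a = y then det (select_mat A (ps[a := k]) qs) else 0)"
proof -
  let ?m = "length ps" and ?B = "select_mat A ps qs"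
  let ?g = "\<lambda>x a b. if qs ! b = x \<and> ps ! a = y then cofactor ?B a b else 0"
  have delta: "(\<Sum>x<n. A $$ (k, x) * ?g x a b) = (if ps ! a = y then A $$ (k, qs ! b) * cofactor ?B a b else 0)"
    if "b < ?m" for a b
  proof -
    have "(\<Sum>x<n. A $$ (k, x) * ?g x a b) = (\<Sum>x<n. if qs ! b = x then A $$ (k, x) * ?g x a b else 0)"
      by (rule sum.cong[OF refl]) simp
    also have "\<dots> = A $$ (k, qs ! b) * ?g (qs ! b) a b"
    proof -
      have "qs ! b < n" using nth_set_lessThan[OF qs] that len by simp
      thus ?thesis by simp
    qed
    finally show ?thesis by simp
  qed
  have laplace: "det (select_mat A (ps[a := k]) qs) = (\<Sum>b<?m. A $$ (k, qs ! b) * cofactor ?B a b)"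
    if "a < ?m" for a
  proof -
    have "det (select_mat A (ps[a := k]) qs)
        = (\<Sum>b<?m. select_mat A (ps[a := k]) qs $$ (a, b) * cofactor (select_mat A (ps[a := k]) qs) a b)"
      by (rule laplace_expansion_row[OF _ that]) (simp add: carrier_matI len)
    also have "\<dots> = (\<Sum>b<?m. A $$ (k, qs ! b) * cofactor ?B a b)"
      by (rule sum.cong[OF refl]) (use that len in \<open>simp add: cofactor_select_mat_update\<close>)
    finally show ?thesis .
  qed
  have "(A * embedded_adj n A ps qs) $$ (k, y) = (\<Sum>x<n. A $$ (k, x) * embedded_adj n A ps qs $$ (x, y))"
    using A k y by (simp add: scalar_prod_def atLeast0LessThan)
  also have "\<dots> = (\<Sum>x<n. \<Sum>a<?m. \<Sum>b<?m. A $$ (k, x) * ?g x a b)"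
    by (rule sum.cong[OF refl]) (simp add: embedded_adj_index y len sum_distrib_left)
  also have "\<dots> = (\<Sum>a<?m. \<Sum>b<?m. \<Sum>x<n. A $$ (k, x) * ?g x a b)"
    by (subst sum.swap) (rule sum.cong[OF refl], rule sum.swap)
  also have "\<dots> = (\<Sum>a<?m. if ps ! a = y then \<Sum>b<?m. A $$ (k, qs ! b) * cofactor ?B a b else 0)"
    by (rule sum.cong[OF refl]) (simp add: delta)
  also have "\<dots> = (\<Sum>a<?m. if ps ! a = y then det (select_mat A (ps[a := k]) qs) else 0)"
    by (rule sum.cong[OF refl]) (simp add: laplace)
  finally show ?thesis .
qed

lemma select_mat_transpose:
  assumes A: "A \<in> carrier_mat n n" and ps: "set ps \<subseteq> {..<n}" and qs: "set qs \<subseteq> {..<n}"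
  shows "select_mat A\<^sup>T qs ps = (select_mat A ps qs)\<^sup>T"
proof (rule eq_matI)
  fix a b assume "a < dim_row (select_mat A ps qs)\<^sup>T" "b < dim_col (select_mat A ps qs)\<^sup>T"
  moreover from this have "qs ! a < n" "ps ! b < n"
    using nth_set_lessThan[OF qs] nth_set_lessThan[OF ps] by simp_all
  ultimately show "select_mat A\<^sup>T qs ps $$ (a, b) = (select_mat A ps qs)\<^sup>T $$ (a, b)"
    using A by simp
qed simp_all

lemma cofactor_transpose:
  assumes "B \<in> carrier_mat m m"
  shows "cofactor B\<^sup>T a b = cofactor B b a"
proof -
  have "mat_delete B\<^sup>T a b = (mat_delete B b a)\<^sup>T"
    by (rule eq_matI) (use assms in \<open>auto simp: mat_delete_def\<close>)
  moreover have "mat_delete B b a \<in> carrier_mat (m - 1) (m - 1)"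
    using assms by (rule mat_delete_carrier)
  ultimately show ?thesis
    by (simp add: cofactor_def det_transpose add.commute)
qed

lemma embedded_adj_transpose:
  assumes A: "A \<in> carrier_mat n n" and len: "length qs = length ps"
    and ps: "set ps \<subseteq> {..<n}" and qs: "set qs \<subseteq> {..<n}"
  shows "embedded_adj n A\<^sup>T qs ps = (embedded_adj n A ps qs)\<^sup>T"
proof (rule eq_matI)
  fix x y assume "x < dim_row (embedded_adj n A ps qs)\<^sup>T" "y < dim_col (embedded_adj n A ps qs)\<^sup>T"
  hence xy: "x < n" "y < n" by simp_all
  let ?B = "select_mat A ps qs"
  have B: "?B \<in> carrier_mat (length ps) (length ps)"
    using len by (simp add: carrier_matI)
  have cof: "cofactor (select_mat A\<^sup>T qs ps) b a = cofactor ?B a b" for a b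
    by (simp only: select_mat_transpose[OF A ps qs] cofactor_transpose[OF B])
  have "embedded_adj n A\<^sup>T qs ps $$ (x, y) = (\<Sum>b<length qs. \<Sum>a<length ps.
      if ps ! a = x \<and> qs ! b = y then cofactor (select_mat A\<^sup>T qs ps) b a else 0)"
    using xy by (simp add: embedded_adj_index)
  also have "\<dots> = (\<Sum>b<length qs. \<Sum>a<length ps.
      if ps ! a = x \<and> qs ! b = y then cofactor ?B a b else 0)"
    by (simp only: cof)
  also have "\<dots> = (\<Sum>a<length ps. \<Sum>b<length qs. if qs ! b = y \<and> ps ! a = x then cofactor ?B a b else 0)"
    by (subst sum.swap) (simp add: conj_commute)
  also have "\<dots> = (embedded_adj n A ps qs)\<^sup>T $$ (x, y)"
    using xy by (simp add: embedded_adj_index)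
  finally show "embedded_adj n A\<^sup>T qs ps $$ (x, y) = (embedded_adj n A ps qs)\<^sup>T $$ (x, y)" .
qed simp_all

lemma embedded_adj_mult_index:
  fixes A :: "'a::comm_ring_1 mat"
  assumes A: "A \<in> carrier_mat n n" and len: "length qs = length ps"
    and ps: "set ps \<subseteq> {..<n}" and qs: "set qs \<subseteq> {..<n}" and x: "x < n" and l: "l < n"
  shows "(embedded_adj n A ps qs * A) $$ (x, l) =
    (\<Sum>b<length qs. if qs ! b = x then det (select_mat A ps (qs[b := l])) else 0)"
proof -
  have AT: "A\<^sup>T \<in> carrier_mat n n" using A by simp
  have "(embedded_adj n A ps qs * A) $$ (x, l) = (A\<^sup>T * (embedded_adj n A ps qs)\<^sup>T) $$ (l, x)"
    using A x l by (simp add: transpose_mult[symmetric, of _ n n])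
  also have "\<dots> = (A\<^sup>T * embedded_adj n A\<^sup>T qs ps) $$ (l, x)"
    by (simp add: embedded_adj_transpose[OF A len ps qs])
  also have "\<dots> = (\<Sum>b<length qs. if qs ! b = x then det (select_mat A\<^sup>T (qs[b := l]) ps) else 0)"
    using mult_embedded_adj_index[OF AT _ ps l x] len by simp
  also have "\<dots> = (\<Sum>b<length qs. if qs ! b = x then det (select_mat A ps (qs[b := l])) else 0)"
  proof (rule sum.cong[OF refl])
    fix b
    have "set (qs[b := l]) \<subseteq> {..<n}" using qs l by (rule set_update_lessThan)
    hence "det (select_mat A\<^sup>T (qs[b := l]) ps) = det (select_mat A ps (qs[b := l]))"
      using len by (simp add: select_mat_transpose[OF A ps] det_transpose[of _ "length ps"] carrier_matI)
    thus "(if qs ! b = x then det (select_mat A\<^sup>T (qs[b := l]) ps) else 0) =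
        (if qs ! b = x then det (select_mat A ps (qs[b := l])) else 0)" by simp
  qed
  finally show ?thesis .
qed

lemma embedded_adj_append_index:
  assumes len: "length qs = length ps" and i: "i \<notin> set ps" "i < n" and j: "j \<notin> set qs" "j < n"
  shows "embedded_adj n A (ps @ [i]) (qs @ [j]) $$ (j, i) = det (select_mat A ps qs)"
proof -
  let ?t = "length ps" and ?B = "select_mat A (ps @ [i]) (qs @ [j])"
  have pi: "(ps @ [i]) ! a = i \<longleftrightarrow> a = ?t" if "a < Suc ?t" for a
    using that i by (auto simp: nth_append less_Suc_eq)
  have qj: "(qs @ [j]) ! b = j \<longleftrightarrow> b = ?t" if "b < Suc ?t" for b
    using that j len by (auto simp: nth_append less_Suc_eq)
  have "embedded_adj n A (ps @ [i]) (qs @ [j]) $$ (j, i)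
      = (\<Sum>a<Suc ?t. \<Sum>b<Suc ?t. if (qs @ [j]) ! b = j \<and> (ps @ [i]) ! a = i then cofactor ?B a b else 0)"
    using i j len by (simp add: embedded_adj_index del: sum.lessThan_Suc)
  also have "\<dots> = (\<Sum>a<Suc ?t. if a = ?t then \<Sum>b<Suc ?t. if b = ?t then cofactor ?B a b else 0 else 0)"
    by (rule sum.cong[OF refl]) (auto simp: pi qj intro!: sum.cong)
  also have "\<dots> = cofactor ?B ?t ?t"
    by simp
  also have "\<dots> = det (select_mat A ps qs)"
  proof -
    have "mat_delete ?B ?t ?t = select_mat A ps qs"
      using len by (intro eq_matI) (auto simp: mat_delete_def nth_append)
    thus ?thesis by (simp add: cofactor_def)
  qed
  finally show ?thesis .
qed

lemma ex_less_notin_set: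
  assumes "length xs < n"
  shows "\<exists>i<n. i \<notin> set xs"
proof (rule ccontr)
  assume "\<not> (\<exists>i<n. i \<notin> set xs)"
  hence "card {..<n} \<le> card (set xs)" by (intro card_mono) auto
  also have "\<dots> \<le> length xs" by (rule card_length)
  finally show False using assms by simp
qed

lemma embedded_adj_annihilates:
  fixes A :: "'a::comm_ring_1 mat"
  assumes A: "A \<in> carrier_mat n n" and len: "length qs = length ps"
    and ps: "set ps \<subseteq> {..<n}" and qs: "set qs \<subseteq> {..<n}"
    and killed: "\<And>ps' qs'. length ps' = length ps \<Longrightarrow> length qs' = length ps \<Longrightarrow>
      set ps' \<subseteq> {..<n} \<Longrightarrow> set qs' \<subseteq> {..<n} \<Longrightarrow> r * det (select_mat A ps' qs') = 0"
  shows "A * (r \<cdot>\<^sub>m embedded_adj n A ps qs) = 0\<^sub>m n n" and "(r \<cdot>\<^sub>m embedded_adj n A ps qs) * A = 0\<^sub>m n n"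
proof -
  let ?Y = "embedded_adj n A ps qs"
  show "A * (r \<cdot>\<^sub>m ?Y) = 0\<^sub>m n n"
  proof (rule eq_matI)
    fix k y assume "k < dim_row (0\<^sub>m n n :: 'a mat)" "y < dim_col (0\<^sub>m n n :: 'a mat)"
    hence k: "k < n" and y: "y < n" by simp_all
    have "(A * (r \<cdot>\<^sub>m ?Y)) $$ (k, y) = r * (A * ?Y) $$ (k, y)"
      using A k y by (simp add: mult_smult_distrib[OF A])
    also have "\<dots> = (\<Sum>a<length ps. r * (if ps ! a = y then det (select_mat A (ps[a := k]) qs) else 0))"
      by (subst mult_embedded_adj_index[OF A len qs k y]) (simp add: sum_distrib_left)
    also have "\<dots> = 0"
      using ps qs k len by (intro sum.neutral) (simp add: killed set_update_lessThan)
    finally show "(A * (r \<cdot>\<^sub>m ?Y)) $$ (k, y) = 0\<^sub>m n n $$ (k, y)" using k y by simp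
  qed (use A in simp_all)
  show "(r \<cdot>\<^sub>m ?Y) * A = 0\<^sub>m n n"
  proof (rule eq_matI)
    fix x l assume "x < dim_row (0\<^sub>m n n :: 'a mat)" "l < dim_col (0\<^sub>m n n :: 'a mat)"
    hence x: "x < n" and l: "l < n" by simp_all
    have "((r \<cdot>\<^sub>m ?Y) * A) $$ (x, l) = r * (?Y * A) $$ (x, l)"
      using A x l by (simp add: mult_smult_assoc_mat[OF _ A])
    also have "\<dots> = (\<Sum>b<length qs. r * (if qs ! b = x then det (select_mat A ps (qs[b := l])) else 0))"
      by (subst embedded_adj_mult_index[OF A len ps qs x l]) (simp add: sum_distrib_left)
    also have "\<dots> = 0"
      using ps qs l len by (intro sum.neutral) (simp add: killed set_update_lessThan)
    finally show "((r \<cdot>\<^sub>m ?Y) * A) $$ (x, l) = 0\<^sub>m n n $$ (x, l)" using x l by simp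
  qed (use A in simp_all)
qed

lemma maximal_unkilled_minor:
  fixes A :: "'a::comm_ring_1 mat"
  assumes A: "A \<in> carrier_mat n n" and r: "r \<noteq> 0" and rdet: "r * det A = 0"
  obtains ps qs where "length ps < n" "length qs = length ps" "set ps \<subseteq> {..<n}" "set qs \<subseteq> {..<n}"
    "r * det (select_mat A ps qs) \<noteq> 0"
    "\<And>ps' qs'. length ps' = Suc (length ps) \<Longrightarrow> length qs' = Suc (length ps) \<Longrightarrow>
      set ps' \<subseteq> {..<n} \<Longrightarrow> set qs' \<subseteq> {..<n} \<Longrightarrow> r * det (select_mat A ps' qs') = 0"
proof -
  define unkilled where "unkilled t \<longleftrightarrow> (\<exists>ps qs. length ps = t \<and> length qs = t \<and>
    set ps \<subseteq> {..<n} \<and> set qs \<subseteq> {..<n} \<and> r * det (select_mat A ps qs) \<noteq> 0)" for t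
  have "unkilled 0"
    using r unfolding unkilled_def by (intro exI[of _ "[]"]) (simp add: carrier_matI)
  moreover have "\<not> unkilled n"
  proof
    assume "unkilled n"
    then obtain ps qs where "length ps = n" "length qs = n" "set ps \<subseteq> {..<n}" "set qs \<subseteq> {..<n}"
      and nz: "r * det (select_mat A ps qs) \<noteq> 0"
      unfolding unkilled_def by blast
    then obtain c where "det (select_mat A ps qs) = det A * c"
      using det_dvd_det_select_mat[OF A] by blast
    thus False using nz rdet by (simp add: mult.assoc[symmetric])
  qed
  ultimately obtain t where "unkilled t" and dead: "\<not> unkilled (Suc t)" and "t < n"
    using ex_least_nat_less[of "\<lambda>t. \<not> unkilled t" n] by auto
  then obtain ps qs where "length ps = t" "length qs = t" "set ps \<subseteq> {..<n}" "set qs \<subseteq> {..<n}"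
    "r * det (select_mat A ps qs) \<noteq> 0"
    unfolding unkilled_def by blast
  moreover have "r * det (select_mat A ps' qs') = 0"
    if "length ps' = Suc t" "length qs' = Suc t" "set ps' \<subseteq> {..<n}" "set qs' \<subseteq> {..<n}" for ps' qs'
    using dead that unfolding unkilled_def by blast
  ultimately show thesis
    using that[of ps qs] \<open>t < n\<close> by simp
qed

text \<open>McCoy's argument: if \<open>t\<close> is maximal such that some \<open>t\<close>-minor of \<open>A\<close> is not killed by \<open>r\<close>,
  then \<open>r\<close> times the adjugate of a \<open>(t + 1)\<close>-minor extending it annihilates \<open>A\<close> on both sides,
  and its entry at the new position is that surviving \<open>t\<close>-minor.\<close>

theorem mccoy_two_sided:
  fixes A :: "'a::comm_ring_1 mat"
  assumes A: "A \<in> carrier_mat n n" and r: "r \<noteq> 0" and rdet: "r * det A = 0"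
  shows "\<exists>Y \<in> carrier_mat n n. r \<cdot>\<^sub>m Y \<noteq> 0\<^sub>m n n \<and> A * (r \<cdot>\<^sub>m Y) = 0\<^sub>m n n \<and> (r \<cdot>\<^sub>m Y) * A = 0\<^sub>m n n"
proof -
  obtain ps qs where t: "length ps < n" and len: "length qs = length ps"
    and ps: "set ps \<subseteq> {..<n}" and qs: "set qs \<subseteq> {..<n}" and nz: "r * det (select_mat A ps qs) \<noteq> 0"
    and killed: "\<And>ps' qs'. length ps' = Suc (length ps) \<Longrightarrow> length qs' = Suc (length ps) \<Longrightarrow>
      set ps' \<subseteq> {..<n} \<Longrightarrow> set qs' \<subseteq> {..<n} \<Longrightarrow> r * det (select_mat A ps' qs') = 0"
    by (rule maximal_unkilled_minor[OF assms], rule that)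
  obtain i where i: "i < n" "i \<notin> set ps" using ex_less_notin_set t by blast
  obtain j where j: "j < n" "j \<notin> set qs" using ex_less_notin_set[of qs n] t len by auto
  define Y where "Y = embedded_adj n A (ps @ [i]) (qs @ [j])"
  have ps': "set (ps @ [i]) \<subseteq> {..<n}" and qs': "set (qs @ [j]) \<subseteq> {..<n}"
    and len': "length (qs @ [j]) = length (ps @ [i])"
    using ps qs i j len by simp_all
  have "A * (r \<cdot>\<^sub>m Y) = 0\<^sub>m n n" "(r \<cdot>\<^sub>m Y) * A = 0\<^sub>m n n"
    unfolding Y_def using embedded_adj_annihilates[OF A len' ps' qs'] killed by simp_all
  moreover have "r \<cdot>\<^sub>m Y \<noteq> 0\<^sub>m n n"
  proof
    assume "r \<cdot>\<^sub>m Y = 0\<^sub>m n n"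
    hence "(r \<cdot>\<^sub>m Y) $$ (j, i) = 0" using i j by simp
    moreover have "Y $$ (j, i) = det (select_mat A ps qs)"
      unfolding Y_def using len i j by (intro embedded_adj_append_index)
    ultimately show False using nz i j by (simp add: Y_def)
  qed
  moreover have "Y \<in> carrier_mat n n" by (simp add: Y_def)
  ultimately show ?thesis by blast
qed

section \<open>Matrices indexed by a finite type\<close>

hide_const (open) Matrix.mat
no_notation Matrix.vec_index (infixl "$" 100)

definition cart_index :: "nat \<Rightarrow> 'n::finite" where
  "cart_index = (SOME e. bij_betw e {..<CARD('n)} UNIV)"

lemma bij_cart_index: "bij_betw (cart_index :: nat \<Rightarrow> 'n::finite) {..<CARD('n)} UNIV"
proof -
  have "\<exists>e :: nat \<Rightarrow> 'n. bij_betw e {..<CARD('n)} UNIV"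
    using ex_bij_betw_nat_finite[of "UNIV :: 'n set"] by (simp add: atLeast0LessThan)
  thus ?thesis unfolding cart_index_def by (rule someI_ex)
qed

definition mat_of_cart :: "'a^'n^'n::finite \<Rightarrow> 'a mat" where
  "mat_of_cart M = Matrix.mat CARD('n) CARD('n) (\<lambda>(a, b). M $ cart_index a $ cart_index b)"

definition cart_of_mat :: "'a mat \<Rightarrow> 'a^'n^'n::finite" where
  "cart_of_mat C = (\<chi> u v. C $$ (the_inv_into {..<CARD('n)} cart_index u, the_inv_into {..<CARD('n)} cart_index v))"

lemma mat_of_cart_carrier [simp]: "mat_of_cart (M :: 'a^'n^'n::finite) \<in> carrier_mat CARD('n) CARD('n)"
  and mat_of_cart_dim [simp]: "dim_row (mat_of_cart M) = CARD('n)" "dim_col (mat_of_cart M) = CARD('n)"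
  by (simp_all add: mat_of_cart_def)

lemma mat_of_cart_index [simp]:
  "a < CARD('n) \<Longrightarrow> b < CARD('n) \<Longrightarrow> mat_of_cart (M :: 'a^'n^'n::finite) $$ (a, b) = M $ cart_index a $ cart_index b"
  by (simp add: mat_of_cart_def)

lemma cart_of_mat_of_cart [simp]: "cart_of_mat (mat_of_cart M) = (M :: 'a^'n^'n::finite)"
proof -
  have inj: "inj_on (cart_index :: nat \<Rightarrow> 'n) {..<CARD('n)}" and surj: "u \<in> (cart_index :: nat \<Rightarrow> 'n) ` {..<CARD('n)}" for u
    using bij_cart_index[where 'n = 'n] by (auto simp: bij_betw_def)
  have "cart_index (the_inv_into {..<CARD('n)} cart_index u) = u"
    and "the_inv_into {..<CARD('n)} cart_index u < CARD('n)" for u :: 'n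
    using f_the_inv_into_f[OF inj surj] the_inv_into_into[OF inj surj, of "{..<CARD('n)}"] by simp_all
  thus ?thesis by (simp add: cart_of_mat_def vec_eq_iff)
qed

lemma mat_of_cart_inject: "mat_of_cart M = mat_of_cart K \<longleftrightarrow> M = (K :: 'a^'n^'n::finite)"
  by (metis cart_of_mat_of_cart)

lemma mat_of_cart_of_mat:
  assumes "C \<in> carrier_mat CARD('n) CARD('n)"
  shows "mat_of_cart (cart_of_mat C :: 'a^'n^'n::finite) = C"
proof (rule eq_matI)
  fix a b assume "a < dim_row C" "b < dim_col C"
  moreover have "inj_on (cart_index :: nat \<Rightarrow> 'n) {..<CARD('n)}"
    using bij_cart_index bij_betw_def by blast
  ultimately show "mat_of_cart (cart_of_mat C :: 'a^'n^'n) $$ (a, b) = C $$ (a, b)"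
    using assms by (simp add: cart_of_mat_def the_inv_into_f_f)
qed (use assms in auto)

lemma mat_of_cart_mult:
  "mat_of_cart (M ** K) = mat_of_cart M * mat_of_cart (K :: 'a::comm_ring_1^'n::finite^'n)"
proof (rule eq_matI)
  fix a b assume "a < dim_row (mat_of_cart M * mat_of_cart K)" "b < dim_col (mat_of_cart M * mat_of_cart K)"
  hence a: "a < CARD('n)" and b: "b < CARD('n)" by simp_all
  have "mat_of_cart (M ** K) $$ (a, b) = (\<Sum>k\<in>UNIV. M $ cart_index a $ k * K $ k $ cart_index b)"
    using a b by (simp add: matrix_matrix_mult_def)
  also have "\<dots> = (\<Sum>c<CARD('n). M $ cart_index a $ cart_index c * K $ cart_index c $ cart_index b)"
    by (rule sum.reindex_bij_betw[OF bij_cart_index, symmetric])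
  also have "\<dots> = (mat_of_cart M * mat_of_cart K) $$ (a, b)"
    using a b by (simp add: scalar_prod_def atLeast0LessThan)
  finally show "mat_of_cart (M ** K) $$ (a, b) = (mat_of_cart M * mat_of_cart K) $$ (a, b)" .
qed simp_all

lemma mat_of_cart_zero [simp]: "mat_of_cart (0 :: 'a::zero^'n^'n::finite) = 0\<^sub>m CARD('n) CARD('n)"
  by (rule eq_matI) simp_all

lemma mat_of_cart_mat: "mat_of_cart (mat c :: 'a::comm_ring_1^'n^'n::finite) = c \<cdot>\<^sub>m 1\<^sub>m CARD('n)"
proof -
  have "inj_on (cart_index :: nat \<Rightarrow> 'n) {..<CARD('n)}"
    using bij_cart_index bij_betw_def by blast
  thus ?thesis by (intro eq_matI) (auto simp: Finite_Cartesian_Product.mat_def inj_on_eq_iff)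
qed

lemma det_mat_of_cart_zero_divisor:
  fixes A X :: "'a::comm_ring_1^'n::finite^'n"
  assumes X: "X \<noteq> 0" and AX: "A ** X = 0"
  shows "det (mat_of_cart A) \<in> zero_divisors"
proof -
  let ?A = "mat_of_cart A" and ?X = "mat_of_cart X" and ?n = "CARD('n)"
  have adj: "adj_mat ?A \<in> carrier_mat ?n ?n" "adj_mat ?A * ?A = det ?A \<cdot>\<^sub>m 1\<^sub>m ?n"
    using adj_mat[OF mat_of_cart_carrier[of A]] by simp_all
  have "det ?A \<cdot>\<^sub>m ?X = adj_mat ?A * (?A * ?X)"
    using adj by (simp add: assoc_mult_mat[OF adj(1) mat_of_cart_carrier mat_of_cart_carrier, symmetric]
      mult_smult_assoc_mat[OF one_carrier_mat mat_of_cart_carrier])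
  also have "?A * ?X = 0\<^sub>m ?n ?n"
    using AX by (simp add: mat_of_cart_mult[symmetric])
  finally have kill: "det ?A \<cdot>\<^sub>m ?X = 0\<^sub>m ?n ?n"
    using adj(1) by simp
  obtain a b where ab: "a < ?n" "b < ?n" "?X $$ (a, b) \<noteq> 0"
  proof -
    have "?X \<noteq> 0\<^sub>m ?n ?n"
      using X mat_of_cart_inject[of X 0] by simp
    moreover have "?X = 0\<^sub>m ?n ?n" if "\<And>a b. a < ?n \<Longrightarrow> b < ?n \<Longrightarrow> ?X $$ (a, b) = 0"
      using that by (intro eq_matI) simp_all
    ultimately show ?thesis using that by blast
  qed
  have "det ?A * ?X $$ (a, b) = 0"
    using arg_cong[OF kill, of "\<lambda>M. M $$ (a, b)"] ab by simp
  thus ?thesis unfolding zero_divisors_def using ab(3) by blast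
qed

lemma mccoy_two_sided_cart:
  fixes A :: "'a::comm_ring_1^'n::finite^'n"
  assumes "a \<noteq> 0" and "a * det (mat_of_cart A) = 0"
  shows "\<exists>Y. mat a ** Y \<noteq> 0 \<and> A ** (mat a ** Y) = 0 \<and> (mat a ** Y) ** A = 0"
proof -
  obtain Y where Y: "Y \<in> carrier_mat CARD('n) CARD('n)" and Y0: "a \<cdot>\<^sub>m Y \<noteq> 0\<^sub>m CARD('n) CARD('n)"
    and AY: "mat_of_cart A * (a \<cdot>\<^sub>m Y) = 0\<^sub>m CARD('n) CARD('n)"
    and YA: "(a \<cdot>\<^sub>m Y) * mat_of_cart A = 0\<^sub>m CARD('n) CARD('n)"
    using mccoy_two_sided[OF mat_of_cart_carrier assms] by blast
  define Y' where "Y' = (mat a ** cart_of_mat Y :: 'a^'n^'n)"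
  have Y': "mat_of_cart Y' = a \<cdot>\<^sub>m Y"
    using Y by (simp add: Y'_def mat_of_cart_mult mat_of_cart_mat mat_of_cart_of_mat
      mult_smult_assoc_mat[OF one_carrier_mat Y])
  have "Y' \<noteq> 0" "A ** Y' = 0" "Y' ** A = 0"
    using Y0 AY YA by (simp_all flip: mat_of_cart_inject add: mat_of_cart_mult Y')
  thus ?thesis unfolding Y'_def by blast
qed

lemma vertex_det_zero_divisor:
  fixes A :: "'a::comm_ring_1^'n::finite^'n"
  assumes "A \<in> orth_vertices (**)"
  shows "det (mat_of_cart A) \<in> zero_divisors"
  using assms det_mat_of_cart_zero_divisor unfolding orth_vertices_def by blast

lemma vertex_two_sided_annihilator:
  fixes A :: "'a::comm_ring_1^'n::finite^'n"
  assumes "A \<in> orth_vertices (**)"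
  shows "\<exists>C. C \<noteq> 0 \<and> A ** C = 0 \<and> C ** A = 0"
proof -
  obtain r where "r \<noteq> 0" "det (mat_of_cart A) * r = 0"
    using vertex_det_zero_divisor[OF assms] unfolding zero_divisors_def by blast
  thus ?thesis using mccoy_two_sided_cart[of r A] by (auto simp: mult.commute)
qed

section \<open>Walks and distances in orthogonality graphs\<close>

lemma orth_verticesI: "x \<noteq> 0 \<Longrightarrow> y \<noteq> 0 \<Longrightarrow> m x y = 0 \<Longrightarrow> m y x = 0 \<Longrightarrow> x \<in> orth_vertices m"
  unfolding orth_vertices_def by blast

lemma orth_vertices_nonzero: "x \<in> orth_vertices m \<Longrightarrow> x \<noteq> 0"
  unfolding orth_vertices_def by blast

lemma orth_walk_0_iff: "orth_walk m x y 0 \<longleftrightarrow> x = y"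
  unfolding orth_walk_def by auto

lemma orth_walk_Suc_iff: "orth_walk m x z (Suc k) \<longleftrightarrow> (\<exists>y. orth_adj m x y \<and> orth_walk m y z k)"
proof
  assume "orth_walk m x z (Suc k)"
  then obtain p where p: "p 0 = x" "p (Suc k) = z" "\<forall>i<Suc k. orth_adj m (p i) (p (Suc i))"
    unfolding orth_walk_def by blast
  hence "orth_adj m x (p 1)" "orth_walk m (p 1) z k"
    unfolding orth_walk_def by (auto intro!: exI[of _ "\<lambda>i. p (Suc i)"])
  thus "\<exists>y. orth_adj m x y \<and> orth_walk m y z k" by blast
next
  assume "\<exists>y. orth_adj m x y \<and> orth_walk m y z k"
  then obtain y p where "orth_adj m x y" "p 0 = y" "p k = z" "\<forall>i<k. orth_adj m (p i) (p (Suc i))"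
    unfolding orth_walk_def by blast
  thus "orth_walk m x z (Suc k)"
    unfolding orth_walk_def by (intro exI[of _ "case_nat x p"]) (auto simp: less_Suc_eq_0_disj)
qed

lemma orth_dist_le_iff: "orth_dist m x y \<le> enat k \<longleftrightarrow> (\<exists>k'\<le>k. orth_walk m x y k')"
proof
  assume "orth_dist m x y \<le> enat k"
  then obtain k' where "orth_walk m x y k'" "(LEAST k. orth_walk m x y k) \<le> k"
    unfolding orth_dist_def by (auto split: if_splits)
  thus "\<exists>k'\<le>k. orth_walk m x y k'"
    by (meson LeastI)
next
  assume "\<exists>k'\<le>k. orth_walk m x y k'"
  then obtain k' where "k' \<le> k" "orth_walk m x y k'" by blast
  thus "orth_dist m x y \<le> enat k"
    unfolding orth_dist_def by (auto intro: Least_le order_trans)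
qed

lemma orth_dist_ge:
  assumes "\<And>k. k < K \<Longrightarrow> \<not> orth_walk m x y k"
  shows "enat K \<le> orth_dist m x y"
  using assms orth_dist_le_iff[of m x y] unfolding orth_dist_def
  by (auto simp: not_less[symmetric] intro: LeastI2_ex)

lemma orth_dist_self: "orth_dist m x x \<le> enat 0"
  by (simp add: orth_dist_le_iff orth_walk_0_iff)

lemma orth_dist_cons:
  assumes "orth_dist m y z \<le> enat k" and "x \<noteq> 0" "y \<noteq> 0" "m x y = 0" "m y x = 0"
  shows "orth_dist m x z \<le> enat (Suc k)"
proof (cases "x = y")
  case True
  thus ?thesis using assms(1) order_trans by fastforce
next
  case False
  hence "orth_adj m x y"
    using assms(2-) orth_verticesI unfolding orth_adj_def by metis
  moreover obtain k' where "k' \<le> k" "orth_walk m y z k'"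
    using assms(1) by (auto simp: orth_dist_le_iff)
  ultimately have "orth_walk m x z (Suc k')" "Suc k' \<le> Suc k"
    by (auto simp: orth_walk_Suc_iff)
  thus ?thesis by (auto simp: orth_dist_le_iff)
qed

text \<open>Consecutive entries of an annihilating chain may coincide, so its length only bounds the
  distance between its ends.\<close>

fun annihilating_chain :: "('b::zero \<Rightarrow> 'b \<Rightarrow> 'b) \<Rightarrow> 'b list \<Rightarrow> bool" where
  "annihilating_chain m (x # y # zs) \<longleftrightarrow>
     x \<noteq> 0 \<and> y \<noteq> 0 \<and> m x y = 0 \<and> m y x = 0 \<and> annihilating_chain m (y # zs)"
| "annihilating_chain m _ \<longleftrightarrow> True"

lemma orth_dist_annihilating_chain:
  "annihilating_chain m (x # ys) \<Longrightarrow> orth_dist m x (last (x # ys)) \<le> enat (length ys)"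
proof (induction ys arbitrary: x)
  case Nil
  thus ?case by (simp add: orth_dist_self)
next
  case (Cons y ys)
  hence "orth_dist m y (last (y # ys)) \<le> enat (length ys)" by simp
  thus ?case using Cons.prems by (auto intro: orth_dist_cons)
qed

lemma orth_diam_le:
  "(\<And>x y. x \<in> orth_vertices m \<Longrightarrow> y \<in> orth_vertices m \<Longrightarrow> orth_dist m x y \<le> d) \<Longrightarrow> orth_diam m \<le> d"
  unfolding orth_diam_def by (intro SUP_least)

lemma orth_diam_ge:
  "x \<in> orth_vertices m \<Longrightarrow> y \<in> orth_vertices m \<Longrightarrow> d \<le> orth_dist m x y \<Longrightarrow> d \<le> orth_diam m"
  unfolding orth_diam_def by (blast intro: SUP_upper2)


section \<open>Scalar matrices and the upper bounds\<close>

lemma mat_mult_nth: "(mat c ** M) $ i $ j = c * (M :: 'a::comm_ring_1^'n^'m) $ i $ j"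
proof -
  have "(mat c ** M) $ i $ j = (\<Sum>k\<in>UNIV. (if i = k then c else 0) * M $ k $ j)"
    by (simp add: matrix_matrix_mult_def Finite_Cartesian_Product.mat_def)
  also have "\<dots> = (\<Sum>k\<in>UNIV. if i = k then c * M $ k $ j else 0)"
    by (rule sum.cong) auto
  finally show ?thesis by simp
qed

lemma mult_mat_nth: "(M ** mat c) $ i $ j = (M :: 'a::comm_ring_1^'n^'m) $ i $ j * c"
proof -
  have "(M ** mat c) $ i $ j = (\<Sum>k\<in>UNIV. M $ i $ k * (if k = j then c else 0))"
    by (simp add: matrix_matrix_mult_def Finite_Cartesian_Product.mat_def)
  also have "\<dots> = (\<Sum>k\<in>UNIV. if j = k then M $ i $ k * c else 0)"
    by (rule sum.cong) auto
  finally show ?thesis by simp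
qed

lemma mult_mat_commute: "M ** mat c = mat c ** (M :: 'a::comm_ring_1^'n^'m)"
  by (simp add: Finite_Cartesian_Product.vec_eq_iff mat_mult_nth mult_mat_nth mult.commute)

lemma mat_mult_mat_mult: "mat c ** (mat d ** M) = mat (c * d) ** (M :: 'a::comm_ring_1^'n^'m)"
  by (simp add: Finite_Cartesian_Product.vec_eq_iff mat_mult_nth mult.assoc)

lemma mult_mat_mult: "M ** (mat c ** K) = mat c ** (M ** (K :: 'a::comm_ring_1^'p^'n))"
  by (metis matrix_mul_assoc mult_mat_commute)

lemma mat_mult_mult: "(mat c ** M) ** K = mat c ** (M ** (K :: 'a::comm_ring_1^'p^'n))"
  by (simp add: matrix_mul_assoc)

lemma mat_eq_0_iff [simp]: "(mat c :: 'a::zero^'n^'n) = 0 \<longleftrightarrow> c = 0"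
  by (auto simp: Finite_Cartesian_Product.vec_eq_iff Finite_Cartesian_Product.mat_def)

lemma mat_mult_mult_eq_0_left: "mat c ** M = 0 \<Longrightarrow> mat c ** (M ** (K :: 'a::comm_ring_1^'p^'n)) = 0"
  by (simp flip: mat_mult_mult)

lemma mat_mult_mult_eq_0_right: "mat c ** K = 0 \<Longrightarrow> mat c ** (M ** (K :: 'a::comm_ring_1^'p^'n)) = 0"
  by (simp flip: mult_mat_mult)

lemma vertex_annihilator_killed_by_scalar:
  fixes A :: "'a::comm_ring_1^'n::finite^'n" and z w :: 'a
  assumes A: "A \<in> orth_vertices (**)" and zw: "z \<noteq> 0" "w \<noteq> 0" "z * w = 0"
  shows "\<exists>C b. C \<noteq> 0 \<and> A ** C = 0 \<and> C ** A = 0 \<and> b \<noteq> 0 \<and> mat b ** C = 0"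
proof -
  obtain C where C: "C \<noteq> 0" "A ** C = 0" "C ** A = 0"
    using vertex_two_sided_annihilator[OF A] by blast
  show ?thesis
  proof (cases "mat w ** C = 0")
    case True
    thus ?thesis using C zw by blast
  next
    case False
    moreover have "A ** (mat w ** C) = 0" "(mat w ** C) ** A = 0"
      using C by (simp_all add: mult_mat_mult mat_mult_mult)
    moreover have "mat z ** (mat w ** C) = 0"
      using zw by (simp add: mat_mult_mat_mult)
    ultimately show ?thesis using zw by blast
  qed
qed

lemma orth_dist_scalar_le_2:
  fixes A :: "'a::comm_ring_1^'n::finite^'n" and z w :: 'a
  assumes A: "A \<in> orth_vertices (**)" and zw: "z \<noteq> 0" "w \<noteq> 0" "z * w = 0"
  shows "\<exists>b. (mat b :: 'a^'n^'n) \<in> orth_vertices (**) \<and> orth_dist (**) A (mat b) \<le> 2"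
proof -
  obtain C b where C: "C \<noteq> 0" "A ** C = 0" "C ** A = 0" and b: "b \<noteq> 0" "mat b ** C = 0"
    using vertex_annihilator_killed_by_scalar[OF A zw] by blast
  have Cb: "C ** mat b = 0" using b by (simp add: mult_mat_commute)
  have "(mat b :: 'a^'n^'n) \<in> orth_vertices (**)"
    using b C Cb orth_verticesI[of "mat b" C "(**)"] by simp
  moreover have "annihilating_chain (**) [A, C, mat b :: 'a^'n^'n]"
    using orth_vertices_nonzero[OF A] C b Cb by simp
  note orth_dist_annihilating_chain[OF this]
  ultimately show ?thesis by (auto simp: numeral_eq_enat eval_nat_numeral)
qed

lemma mat_mult_mat_mult_eq_0:
  "c * d = 0 \<Longrightarrow> (mat c ** M) ** (mat d ** K) = (0 :: 'a::comm_ring_1^'p^'m)"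
proof -
  assume cd: "c * d = 0"
  have "(mat c ** M) ** (mat d ** K) = mat c ** (mat d ** (M ** K))"
    by (metis mat_mult_mult mult_mat_mult)
  also have "\<dots> = mat (c * d) ** (M ** K)"
    by (rule mat_mult_mat_mult)
  finally show ?thesis using cd by simp
qed

lemma orth_dist_le_4:
  fixes A B :: "'a::comm_ring_1^'n::finite^'n" and z w :: 'a
  assumes A: "A \<in> orth_vertices (**)" and B: "B \<in> orth_vertices (**)"
    and zw: "z \<noteq> 0" "w \<noteq> 0" "z * w = 0"
  shows "orth_dist (**) A B \<le> 4"
proof -
  obtain P p where P: "P \<noteq> 0" "A ** P = 0" "P ** A = 0" and p: "p \<noteq> 0" "mat p ** P = 0"
    using vertex_annihilator_killed_by_scalar[OF A zw] by blast
  obtain Q where Q: "Q \<noteq> 0" "B ** Q = 0" "Q ** B = 0"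
    using vertex_two_sided_annihilator[OF B] by blast
  have AB: "A \<noteq> 0" "B \<noteq> 0" using A B orth_vertices_nonzero by blast+
  have Pp: "P ** mat p = 0" using p by (simp add: mult_mat_commute)
  show ?thesis
  proof (cases "mat p ** Q = 0")
    case True
    hence "Q ** mat p = 0" by (simp add: mult_mat_commute)
    hence "annihilating_chain (**) [A, P, mat p, Q, B]"
      using AB P p Pp Q True by simp
    from orth_dist_annihilating_chain[OF this] show ?thesis by (simp add: numeral_eq_enat eval_nat_numeral)
  next
    case False
    have "P ** (mat p ** Q) = 0" "(mat p ** Q) ** P = 0"
      using p by (simp_all add: mult_mat_mult mat_mult_mult mat_mult_mult_eq_0_left mat_mult_mult_eq_0_right)
    moreover have "B ** (mat p ** Q) = 0" "(mat p ** Q) ** B = 0"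
      using Q by (simp_all add: mult_mat_mult mat_mult_mult)
    ultimately have "annihilating_chain (**) [A, P, mat p ** Q, B]"
      using AB P False by simp
    from orth_dist_annihilating_chain[OF this] have "orth_dist (**) A B \<le> 3"
      by (simp add: numeral_eq_enat eval_nat_numeral)
    thus ?thesis by (rule order_trans) (simp add: numeral_eq_enat)
  qed
qed

definition has_orth_annihilators :: "'a::comm_ring_1 \<Rightarrow> bool" where
  "has_orth_annihilators a \<longleftrightarrow> (\<exists>a1 a2. a1 \<noteq> 0 \<and> a2 \<noteq> 0 \<and> a * a1 = 0 \<and> a * a2 = 0 \<and> a1 * a2 = 0)"

lemma orth_dist_le_3:
  fixes A B :: "'a::comm_ring_1^'n::finite^'n"
  assumes A: "A \<in> orth_vertices (**)" and B: "B \<in> orth_vertices (**)"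
    and det_A: "has_orth_annihilators (det (mat_of_cart A))"
  shows "orth_dist (**) A B \<le> 3"
proof -
  obtain a1 a2 where a: "a1 \<noteq> 0" "a2 \<noteq> 0" "a1 * det (mat_of_cart A) = 0" "a2 * det (mat_of_cart A) = 0"
    and a12: "a1 * a2 = 0"
    using det_A unfolding has_orth_annihilators_def by (auto simp: mult.commute)
  obtain X1 where X1: "mat a1 ** X1 \<noteq> 0" "A ** (mat a1 ** X1) = 0" "(mat a1 ** X1) ** A = 0"
    using mccoy_two_sided_cart[OF a(1,3)] by blast
  obtain X2 where X2: "mat a2 ** X2 \<noteq> 0" "A ** (mat a2 ** X2) = 0" "(mat a2 ** X2) ** A = 0"
    using mccoy_two_sided_cart[OF a(2,4)] by blast
  obtain Y where Y: "Y \<noteq> 0" "B ** Y = 0" "Y ** B = 0"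
    using vertex_two_sided_annihilator[OF B] by blast
  have AB: "A \<noteq> 0" "B \<noteq> 0" using A B orth_vertices_nonzero by blast+
  show ?thesis
  proof (cases "mat a1 ** Y = 0")
    case True
    have "(mat a1 ** X1) ** Y = 0" "Y ** (mat a1 ** X1) = 0"
      using True by (simp_all add: mult_mat_mult mat_mult_mult mat_mult_mult_eq_0_left mat_mult_mult_eq_0_right)
    hence "annihilating_chain (**) [A, mat a1 ** X1, Y, B]"
      using AB X1 Y by simp
    from orth_dist_annihilating_chain[OF this] show ?thesis by (simp add: numeral_eq_enat eval_nat_numeral)
  next
    case False
    have "(mat a2 ** X2) ** (mat a1 ** Y) = 0" "(mat a1 ** Y) ** (mat a2 ** X2) = 0"
      using a12 by (simp_all add: mat_mult_mat_mult_eq_0 mult.commute)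
    moreover have "B ** (mat a1 ** Y) = 0" "(mat a1 ** Y) ** B = 0"
      using Y by (simp_all add: mult_mat_mult mat_mult_mult)
    ultimately have "annihilating_chain (**) [A, mat a2 ** X2, mat a1 ** Y, B]"
      using AB X2 False by simp
    from orth_dist_annihilating_chain[OF this] show ?thesis by (simp add: numeral_eq_enat eval_nat_numeral)
  qed
qed

lemma orth_diam_le_4:
  fixes z w :: "'a::comm_ring_1"
  assumes "z \<noteq> 0" "w \<noteq> 0" "z * w = 0"
  shows "orth_diam ((**) :: 'a^'n::finite^'n \<Rightarrow> 'a^'n^'n \<Rightarrow> 'a^'n^'n) \<le> 4"
  using orth_dist_le_4[OF _ _ assms] by (intro orth_diam_le)

lemma orth_diam_le_3:
  assumes "\<forall>a \<in> (zero_divisors :: 'a::comm_ring_1 set). has_orth_annihilators a"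
  shows "orth_diam ((**) :: 'a^'n::finite^'n \<Rightarrow> 'a^'n^'n \<Rightarrow> 'a^'n^'n) \<le> 3"
  using orth_dist_le_3 vertex_det_zero_divisor assms by (intro orth_diam_le) blast

section \<open>The lower bounds\<close>

text \<open>The witnesses for the lower bounds: \<open>scaled_perm_mat id i a\<close> is the diagonal matrix with
  \<open>a\<close> at position \<open>i\<close> and \<open>1\<close> elsewhere, and
  \<open>scaled_perm_mat (Transposition.transpose i j) j a = E\<^sub>i\<^sub>j + a E\<^sub>j\<^sub>i + \<Sum>\<^sub>k\<^sub>\<noteq>\<^sub>i\<^sub>,\<^sub>j E\<^sub>k\<^sub>k\<close>.\<close>

definition scaled_perm_mat :: "('n::finite \<Rightarrow> 'n) \<Rightarrow> 'n \<Rightarrow> 'a::comm_ring_1 \<Rightarrow> 'a^'n^'n" where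
  "scaled_perm_mat \<sigma> p a = (\<chi> k l. if l = \<sigma> k then (if k = p then a else 1) else 0)"

lemma sum_UNIV_single:
  fixes f :: "'n::finite \<Rightarrow> 'a::comm_monoid_add"
  assumes "\<And>m. m \<noteq> t \<Longrightarrow> f m = 0"
  shows "sum f UNIV = f t"
  using sum.mono_neutral_left[of UNIV "{t}" f] assms by simp

lemma scaled_perm_mat_mult_nth:
  "(scaled_perm_mat \<sigma> p a ** D) $ k $ l = (if k = p then a else 1) * D $ \<sigma> k $ l"
proof -
  have "(scaled_perm_mat \<sigma> p a ** D) $ k $ l = (\<Sum>m\<in>UNIV. scaled_perm_mat \<sigma> p a $ k $ m * D $ m $ l)"
    by (simp add: matrix_matrix_mult_def)
  also have "\<dots> = scaled_perm_mat \<sigma> p a $ k $ \<sigma> k * D $ \<sigma> k $ l"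
    by (rule sum_UNIV_single) (simp add: scaled_perm_mat_def)
  finally show ?thesis by (simp add: scaled_perm_mat_def)
qed

lemma mult_scaled_perm_mat_nth:
  assumes "\<And>k. \<sigma> (\<sigma> k) = k"
  shows "(D ** scaled_perm_mat \<sigma> p a) $ k $ l = D $ k $ \<sigma> l * (if \<sigma> l = p then a else 1)"
proof -
  have "(D ** scaled_perm_mat \<sigma> p a) $ k $ l = (\<Sum>m\<in>UNIV. D $ k $ m * scaled_perm_mat \<sigma> p a $ m $ l)"
    by (simp add: matrix_matrix_mult_def)
  also have "\<dots> = D $ k $ \<sigma> l * scaled_perm_mat \<sigma> p a $ \<sigma> l $ l"
    by (rule sum_UNIV_single) (use assms in \<open>auto simp: scaled_perm_mat_def\<close>)
  finally show ?thesis using assms by (simp add: scaled_perm_mat_def)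
qed

lemma scaled_perm_mat_annihilator_iff:
  fixes D :: "'a::comm_ring_1^'n::finite^'n"
  assumes inv: "\<And>k. \<sigma> (\<sigma> k) = k"
  shows "scaled_perm_mat \<sigma> p a ** D = 0 \<and> D ** scaled_perm_mat \<sigma> p a = 0 \<longleftrightarrow>
    D = axis (\<sigma> p) (axis p (D $ \<sigma> p $ p)) \<and> a * D $ \<sigma> p $ p = 0"
    (is "?L \<longleftrightarrow> D = ?E \<and> _")
proof
  assume ?L
  hence "(scaled_perm_mat \<sigma> p a ** D) $ k $ l = 0" "(D ** scaled_perm_mat \<sigma> p a) $ k $ l = 0" for k l
    by simp_all
  hence left: "(if k = p then a else 1) * D $ \<sigma> k $ l = 0"
    and right: "D $ k $ \<sigma> l * (if \<sigma> l = p then a else 1) = 0" for k l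
    by (simp_all only: scaled_perm_mat_mult_nth mult_scaled_perm_mat_nth[OF inv])
  have "D $ k $ l = 0" if "k \<noteq> \<sigma> p \<or> l \<noteq> p" for k l
  proof (cases "k = \<sigma> p")
    case True
    thus ?thesis using that right[of k "\<sigma> l"] by (simp add: inv)
  next
    case False
    hence "\<sigma> k \<noteq> p" by (metis inv)
    thus ?thesis using left[of "\<sigma> k" l] by (simp add: inv)
  qed
  hence "D = ?E"
    by (auto simp: Finite_Cartesian_Product.vec_eq_iff axis_def)
  moreover have "a * D $ \<sigma> p $ p = 0" using left[of p p] by simp
  ultimately show "D = ?E \<and> a * D $ \<sigma> p $ p = 0" ..
next
  assume "D = ?E \<and> a * D $ \<sigma> p $ p = 0"
  then obtain e where D: "D = axis (\<sigma> p) (axis p e)" and ae: "a * e = 0" by auto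
  have inj: "\<sigma> x = \<sigma> y \<longleftrightarrow> x = y" for x y by (metis inv)
  have "scaled_perm_mat \<sigma> p a ** D = 0"
    using ae by (auto simp: Finite_Cartesian_Product.vec_eq_iff scaled_perm_mat_mult_nth D axis_def inj)
  moreover have "D ** scaled_perm_mat \<sigma> p a = 0"
    using ae by (auto simp: Finite_Cartesian_Product.vec_eq_iff mult_scaled_perm_mat_nth[OF inv] D axis_def inv mult.commute)
  ultimately show ?L ..
qed

lemma scaled_perm_mat_vertex:
  fixes a :: "'a::comm_ring_1"
  assumes inv: "\<And>k. \<sigma> (\<sigma> k) = k" and k: "k \<noteq> p" and one: "(1::'a) \<noteq> 0"
    and a: "a \<in> zero_divisors"
  shows "(scaled_perm_mat \<sigma> p a :: 'a^'n::finite^'n) \<in> orth_vertices (**)"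
proof -
  obtain q where q: "q \<noteq> 0" "a * q = 0" using a unfolding zero_divisors_def by blast
  let ?D = "axis (\<sigma> p) (axis p q) :: 'a^'n^'n"
  have "scaled_perm_mat \<sigma> p a ** ?D = 0 \<and> ?D ** scaled_perm_mat \<sigma> p a = 0"
    using q by (simp add: scaled_perm_mat_annihilator_iff[OF inv])
  moreover have "?D \<noteq> 0" using q by simp
  moreover have "(scaled_perm_mat \<sigma> p a :: 'a^'n^'n) $ k $ \<sigma> k = 1"
    using k by (simp add: scaled_perm_mat_def)
  hence "(scaled_perm_mat \<sigma> p a :: 'a^'n^'n) \<noteq> 0" using one by auto
  ultimately show ?thesis by (blast intro: orth_verticesI)
qed

lemma orth_adj_sym: "orth_adj m x y \<Longrightarrow> orth_adj m y x"
  unfolding orth_adj_def by blast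

lemma orth_adj_scaled_perm_mat:
  fixes D :: "'a::comm_ring_1^'n::finite^'n"
  assumes inv: "\<And>k. \<sigma> (\<sigma> k) = k" and adj: "orth_adj (**) (scaled_perm_mat \<sigma> p a) D"
  shows "\<exists>e. e \<noteq> 0 \<and> a * e = 0 \<and> D = axis (\<sigma> p) (axis p e)"
proof -
  have "D = axis (\<sigma> p) (axis p (D $ \<sigma> p $ p)) \<and> a * D $ \<sigma> p $ p = 0"
    using adj unfolding orth_adj_def scaled_perm_mat_annihilator_iff[OF inv, symmetric] by blast
  moreover have "D \<noteq> 0"
    using adj orth_vertices_nonzero unfolding orth_adj_def by blast
  ultimately show ?thesis by (metis axis_eq_0_iff)
qed

lemma axis_mult_axis:
  "axis i (axis j c) ** axis j (axis l d) = (axis i (axis l (c * d)) :: 'a::semiring_1^'n::finite^'m)"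
proof -
  have "(axis i (axis j c) ** axis j (axis l d)) $ k $ m = axis i (axis l (c * d)) $ k $ m" for k m
  proof -
    have "(axis i (axis j c) ** axis j (axis l d)) $ k $ m
        = (\<Sum>t\<in>UNIV. axis i (axis j c) $ k $ t * axis j (axis l d) $ t $ m)"
      by (simp add: matrix_matrix_mult_def)
    also have "\<dots> = axis i (axis j c) $ k $ j * axis j (axis l d) $ j $ m"
      by (rule sum_UNIV_single) (simp add: axis_def)
    finally show ?thesis by (simp add: axis_def)
  qed
  thus ?thesis by (simp add: Finite_Cartesian_Product.vec_eq_iff)
qed

lemma orth_walk_scaled_perm_witnesses:
  fixes a :: "'a::comm_ring_1" and i j :: "'n::finite"
  assumes ij: "i \<noteq> j" and one: "(1::'a) \<noteq> 0"
    and walk: "orth_walk (**) (scaled_perm_mat id i a :: 'a^'n^'n) (scaled_perm_mat (Transposition.transpose i j) j a) k"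
  shows "3 \<le> k \<and> (k = 3 \<longrightarrow> has_orth_annihilators a)"
proof -
  let ?A = "scaled_perm_mat id i a :: 'a^'n^'n" and ?B = "scaled_perm_mat (Transposition.transpose i j) j a :: 'a^'n^'n"
  have nbA: "\<exists>e. e \<noteq> 0 \<and> a * e = 0 \<and> z = axis i (axis i e)" if "orth_adj (**) ?A z" for z
    using orth_adj_scaled_perm_mat[of id i a z] that by simp
  have nbB: "\<exists>e. e \<noteq> 0 \<and> a * e = 0 \<and> y = axis i (axis j e)" if "orth_adj (**) y ?B" for y
    using orth_adj_scaled_perm_mat[of "Transposition.transpose i j" j a y] orth_adj_sym[OF that] by simp
  have Bij: "?B $ i $ j = 1" using ij by (simp add: scaled_perm_mat_def)
  have "k \<noteq> 0"
  proof
    assume "k = 0"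
    hence "?A $ i $ j = ?B $ i $ j" using walk by (simp add: orth_walk_0_iff)
    thus False using Bij ij one by (simp add: scaled_perm_mat_def)
  qed
  moreover have "k \<noteq> 1"
  proof
    assume "k = 1"
    hence "orth_adj (**) ?A ?B" using walk by (simp add: orth_walk_Suc_iff orth_walk_0_iff)
    thus False using nbA[of ?B] Bij ij one by (auto simp: axis_def)
  qed
  moreover have "k \<noteq> 2"
  proof
    assume "k = 2"
    then obtain z where "orth_adj (**) ?A z" "orth_adj (**) z ?B"
      using walk by (auto simp: numeral_2_eq_2 orth_walk_Suc_iff orth_walk_0_iff)
    thus False using nbA nbB ij by (fastforce simp: axis_eq_axis)
  qed
  moreover have "has_orth_annihilators a" if k3: "k = 3"
  proof -
    obtain z y where zy: "orth_adj (**) ?A z" "orth_adj (**) z y" "orth_adj (**) y ?B"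
      using walk k3 by (auto simp: numeral_3_eq_3 orth_walk_Suc_iff orth_walk_0_iff)
    obtain c d where c: "c \<noteq> 0" "a * c = 0" "z = axis i (axis i c)"
      and d: "d \<noteq> 0" "a * d = 0" "y = axis i (axis j d)"
      using nbA[OF zy(1)] nbB[OF zy(3)] by blast
    have "axis i (axis j (c * d)) = z ** y" by (simp add: c(3) d(3) axis_mult_axis)
    also have "\<dots> = 0" using zy(2) unfolding orth_adj_def by blast
    finally have "c * d = 0" by simp
    thus ?thesis using c d unfolding has_orth_annihilators_def by blast
  qed
  ultimately show ?thesis by auto
qed

lemma pairwise_products_eq_0_iff:
  "(let a = [a0, a1, a2] in \<forall>i<3. \<forall>j<3. i \<noteq> j \<longrightarrow> a ! i * a ! j = 0) \<longleftrightarrow>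
   a0 * a1 = 0 \<and> a0 * a2 = 0 \<and> a1 * a2 = (0::'a::comm_ring_1)"
  unfolding Let_def numeral_3_eq_3 by (auto simp: less_Suc_eq mult.commute)

lemma has_orth_annihilators_iff:
  "has_orth_annihilators a0 \<longleftrightarrow> (\<exists>a1 a2. a1 \<noteq> 0 \<and> a2 \<noteq> 0 \<and>
     (let a = [a0, a1, a2] in \<forall>i<3. \<forall>j<3. i \<noteq> j \<longrightarrow> a ! i * a ! j = 0))"
  by (simp only: has_orth_annihilators_def pairwise_products_eq_0_iff)

lemma zero_in_zero_divisors: "(1::'a::comm_ring_1) \<noteq> 0 \<Longrightarrow> 0 \<in> (zero_divisors :: 'a set)"
  unfolding zero_divisors_def by (intro CollectI exI[of _ 1]) simp

lemma ex_nonzero_mult_eq_0: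
  assumes "(1::'a::comm_ring_1) \<noteq> 0" and "(zero_divisors :: 'a set) \<noteq> {0}"
  obtains z w where "z \<noteq> 0" "w \<noteq> 0" "z * w = (0::'a)"
proof -
  have "\<exists>z \<in> (zero_divisors :: 'a set). z \<noteq> 0"
    using assms zero_in_zero_divisors by auto
  thus thesis using that unfolding zero_divisors_def by blast
qed

lemma scaled_perm_witnesses_vertices:
  fixes a :: "'a::comm_ring_1" and i j :: "'n::finite"
  assumes "(1::'a) \<noteq> 0" and "i \<noteq> j" and "a \<in> zero_divisors"
  shows "(scaled_perm_mat id i a :: 'a^'n^'n) \<in> orth_vertices (**)"
    and "(scaled_perm_mat (Transposition.transpose i j) j a :: 'a^'n^'n) \<in> orth_vertices (**)"
  using assms scaled_perm_mat_vertex[of id j i] scaled_perm_mat_vertex[of "Transposition.transpose i j" i j]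
  by auto

lemma orth_diam_ge_3:
  assumes "(1::'a::comm_ring_1) \<noteq> 0" and "(i::'n::finite) \<noteq> j"
  shows "3 \<le> orth_diam ((**) :: 'a^'n^'n \<Rightarrow> 'a^'n^'n \<Rightarrow> 'a^'n^'n)"
proof (rule orth_diam_ge[OF scaled_perm_witnesses_vertices[OF assms zero_in_zero_divisors[OF assms(1)]]])
  show "3 \<le> orth_dist (**) (scaled_perm_mat id i 0 :: 'a^'n^'n) (scaled_perm_mat (Transposition.transpose i j) j 0)"
    using orth_dist_ge[of 3] orth_walk_scaled_perm_witnesses[OF assms(2,1)] by (force simp: numeral_eq_enat)
qed

lemma orth_diam_ge_4:
  fixes a :: "'a::comm_ring_1" and i j :: "'n::finite"
  assumes "(1::'a) \<noteq> 0" and "i \<noteq> j" and "a \<in> zero_divisors" and "\<not> has_orth_annihilators a"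
  shows "4 \<le> orth_diam ((**) :: 'a^'n^'n \<Rightarrow> 'a^'n^'n \<Rightarrow> 'a^'n^'n)"
proof (rule orth_diam_ge[OF scaled_perm_witnesses_vertices[OF assms(1-3)]])
  show "4 \<le> orth_dist (**) (scaled_perm_mat id i a :: 'a^'n^'n) (scaled_perm_mat (Transposition.transpose i j) j a)"
    using orth_dist_ge[of 4] orth_walk_scaled_perm_witnesses[OF assms(2,1)] assms(4)
    by (force simp: numeral_eq_enat)
qed

theorem theorem1:
  assumes nontriv: "(1::'a::comm_ring_1) \<noteq> 0"
    and ZR: "(zero_divisors :: 'a set) \<noteq> {0}"
    and n: "CARD('n::finite) > 1"
  shows "orth_connected ((**) :: 'a^'n^'n \<Rightarrow> 'a^'n^'n \<Rightarrow> 'a^'n^'n)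
    \<and> (orth_diam ((**) :: 'a^'n^'n \<Rightarrow> 'a^'n^'n \<Rightarrow> 'a^'n^'n) = 3
       \<or> orth_diam ((**) :: 'a^'n^'n \<Rightarrow> 'a^'n^'n \<Rightarrow> 'a^'n^'n) = 4)
    \<and> (orth_diam ((**) :: 'a^'n^'n \<Rightarrow> 'a^'n^'n \<Rightarrow> 'a^'n^'n) = 3 \<longleftrightarrow>
         (\<forall>a0 \<in> (zero_divisors :: 'a set). \<exists>a1 a2. a1 \<noteq> 0 \<and> a2 \<noteq> 0 \<and>
            (let a = [a0, a1, a2] in \<forall>i<3. \<forall>j<3. i \<noteq> j \<longrightarrow> a ! i * a ! j = 0)))
    \<and> (\<forall>A \<in> orth_vertices ((**) :: 'a^'n^'n \<Rightarrow> 'a^'n^'n \<Rightarrow> 'a^'n^'n).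
         \<exists>b::'a. mat b \<in> orth_vertices ((**) :: 'a^'n^'n \<Rightarrow> 'a^'n^'n \<Rightarrow> 'a^'n^'n)
           \<and> orth_dist ((**) :: 'a^'n^'n \<Rightarrow> 'a^'n^'n \<Rightarrow> 'a^'n^'n) A (mat b) \<le> 2)"
proof -
  let ?m = "(**) :: 'a^'n^'n \<Rightarrow> 'a^'n^'n \<Rightarrow> 'a^'n^'n"
  obtain i j :: 'n where ij: "i \<noteq> j"
    using n card_le_Suc0_iff_eq[of "UNIV :: 'n set"] by (auto simp: not_le[symmetric])
  obtain z w :: 'a where zw: "z \<noteq> 0" "w \<noteq> 0" "z * w = 0"
    using ex_nonzero_mult_eq_0[OF nontriv ZR] .
  have "3 \<le> orth_diam ?m" "orth_diam ?m \<le> 4"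
    using orth_diam_ge_3[OF nontriv ij] orth_diam_le_4[OF zw] by simp_all
  moreover have "orth_diam ?m \<le> 3" if "\<forall>a \<in> (zero_divisors :: 'a set). has_orth_annihilators a"
    using that by (rule orth_diam_le_3)
  moreover have "4 \<le> orth_diam ?m" if "a \<in> zero_divisors" "\<not> has_orth_annihilators a" for a :: 'a
    using that by (rule orth_diam_ge_4[OF nontriv ij])
  ultimately have "orth_diam ?m = (if \<forall>a \<in> (zero_divisors :: 'a set). has_orth_annihilators a then 3 else 4)"
    by (auto intro: antisym)
  moreover have "orth_connected ?m"
    unfolding orth_connected_def using orth_dist_le_4[OF _ _ zw]
    by (metis enat_ord_simps(5) numeral_ne_infinity)
  moreover have "\<forall>A \<in> orth_vertices ?m. \<exists>b. mat b \<in> orth_vertices ?m \<and> orth_dist ?m A (mat b) \<le> 2"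
    using orth_dist_scalar_le_2[OF _ zw] by blast
  ultimately show ?thesis
    by (simp add: has_orth_annihilators_iff)
qed

end
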